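(* Let $\alpha,\beta>0$ and let $X$ have the gamma distribution with parameters $\alpha$ and $\beta$, i.e. with density $\frac{\beta(\beta x)^{\alpha-1}e^{-\beta x}}{\Gamma(\alpha)}$ for $x>0$ and $0$ for $x<0$. For $i\in\{0,1,2\}$ let $F_i$ be the cumulative distribution function of the gamma distribution with parameters $\alpha+i$ and $\beta$. Then for every real $r\ge 0$, the first-order, complementary and second-order loss functions of $X$ are $$L_1(r)=\frac{\alpha}{\beta}[1-F_1(r)]-r\,[1-F_0(r)],$$ $$L_c(r)=r\,F_0(r)-\frac{\alpha}{\beta}F_1(r),$$ $$L_2(r)=\frac{r^2}{2}[1-F_0(r)]-\frac{r\alpha}{\beta}[1-F_1(r)]+\frac{\alpha(\alpha+1)}{2\beta^2}[1-F_2(r)].$$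
   Context: For a real random variable $X$ with probability density function $g$, the first-order loss function is $L_1(r)=\int_r^\infty(x-r)g(x)\,dx$, the complementary loss function is $L_c(r)=\int_{-\infty}^r(r-x)g(x)\,dx$, and the second-order loss function is $L_2(r)=\frac12\int_r^\infty(x-r)^2g(x)\,dx$. *)

theory Defs
  imports "HOL-Probability.Probability"
begin

(* Lebesgue density; nonnegativity is explicit because ennreal truncates negative values. *)
definition is_pdf :: "'a measure \<Rightarrow> ('a \<Rightarrow> real) \<Rightarrow> (real \<Rightarrow> real) \<Rightarrow> bool" where
  "is_pdf M X g \<longleftrightarrow>
     g \<in> borel_measurable borel \<and> (\<forall>x. 0 \<le> g x) \<and> distributed M lborel X (\<lambda>x. ennreal (g x))"

definition first_order_loss :: "(real \<Rightarrow> real) \<Rightarrow> real \<Rightarrow> real" where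
  "first_order_loss g r = (LBINT x:{r..}. (x - r) * g x)"

definition complementary_loss :: "(real \<Rightarrow> real) \<Rightarrow> real \<Rightarrow> real" where
  "complementary_loss g r = (LBINT x:{..r}. (r - x) * g x)"

definition second_order_loss :: "(real \<Rightarrow> real) \<Rightarrow> real \<Rightarrow> real" where
  "second_order_loss g r = 1 / 2 * (LBINT x:{r..}. (x - r)\<^sup>2 * g x)"

(* Shape a, rate b. The value at 0 is immaterial and set to 0. *)
definition gamma_density :: "real \<Rightarrow> real \<Rightarrow> real \<Rightarrow> real" where
  "gamma_density a b x =
     (if x > 0 then b * (b * x) powr (a - 1) * exp (- (b * x)) / Gamma a else 0)"

definition gamma_distribution :: "real \<Rightarrow> real \<Rightarrow> real measure" where
  "gamma_distribution a b = density lborel (\<lambda>x. ennreal (gamma_density a b x))"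

end

theory Submission
  imports Defs
begin

text \<open>Multiplying the gamma density by \<open>x\<close> raises the shape parameter by one, up to the factor
  \<open>a / b\<close>. Expanding \<open>x - r\<close>, \<open>r - x\<close> and \<open>(x - r)\<^sup>2\<close> therefore
  turns each loss function into a linear combination of lower or upper tails of gamma
  distributions with shapes \<open>\<alpha>\<close>, \<open>\<alpha> + 1\<close> and \<open>\<alpha> + 2\<close>.\<close>

lemma borel_measurable_gamma_density [measurable]: "gamma_density a b \<in> borel_measurable borel"
  unfolding gamma_density_def by measurable

lemma gamma_density_nonneg: "a > 0 \<Longrightarrow> b > 0 \<Longrightarrow> gamma_density a b x \<ge> 0"
  by (auto simp: gamma_density_def intro!: divide_nonneg_pos mult_nonneg_nonneg Gamma_real_pos)

text \<open>The rate is a pure scale parameter, so integrals for rate \<open>b\<close> reduce by a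
  change of variables to rate 1, where Euler's integral for \<open>Gamma\<close> applies.\<close>

lemma gamma_density_scale:
  assumes "b > 0"
  shows "gamma_density a b x = b * gamma_density a 1 (b * x)"
  using assms by (simp add: gamma_density_def zero_less_mult_iff)

text \<open>For \<open>x > 0\<close> the extra factor \<open>x\<close> raises the exponent of
  \<open>b * x\<close> by one at the cost of \<open>1 / b\<close>, and
  \<open>Gamma (a + 1) = a * Gamma a\<close> renormalises at the cost of \<open>a\<close>. Otherwise
  both densities vanish.\<close>

lemma times_gamma_density:
  assumes "a > 0" "b > 0"
  shows "x * gamma_density a b x = a / b * gamma_density (a + 1) b x"
proof (cases "x > 0")
  case True
  have "Gamma (a + 1) = a * Gamma a"
    using assms by (intro Gamma_plus1) (auto elim: nonpos_Ints_cases)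
  moreover have "(b * x) powr a = (b * x) powr (a - 1) * (b * x)"
    using powr_add[of "b * x" "a - 1" 1] True assms by simp
  moreover have "Gamma a > 0"
    using assms by (simp add: Gamma_real_pos)
  ultimately show ?thesis
    using True assms by (simp add: gamma_density_def field_simps)
qed (simp add: gamma_density_def)

lemma nn_integral_gamma_density_unit_rate:
  assumes "a > 0"
  shows "(\<integral>\<^sup>+x. ennreal (gamma_density a 1 x) \<partial>lborel) = 1"
proof -
  have G: "Gamma a > 0"
    using assms by (simp add: Gamma_real_pos)
  have "(\<integral>\<^sup>+x. ennreal (gamma_density a 1 x) \<partial>lborel)
      = (\<integral>\<^sup>+x. ennreal (1 / Gamma a)
            * ennreal (indicator {0..} x * x powr (a - 1) / exp x) \<partial>lborel)"
  proof (rule nn_integral_cong)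
    fix x :: real
    \<comment> \<open>The two sides agree at \<open>x = 0\<close> as well: the indicator of
      \<open>{0..}\<close> is 1 there, but \<open>0 powr (a - 1)\<close> is 0 by convention, for
      every exponent.\<close>
    have "gamma_density a 1 x = 1 / Gamma a * (indicator {0..} x * x powr (a - 1) / exp x)"
      by (simp add: gamma_density_def exp_minus field_simps indicator_def)
    also have "ennreal \<dots> = ennreal (1 / Gamma a)
        * ennreal (indicator {0..} x * x powr (a - 1) / exp x)"
      by (rule ennreal_mult') (use G in simp)
    finally show "ennreal (gamma_density a 1 x) = \<dots>" .
  qed
  also have "\<dots> = ennreal (1 / Gamma a) * ennreal (Gamma a)"
    by (simp add: nn_integral_cmult Gamma_conv_nn_integral_real[OF assms])
  also have "\<dots> = 1"
    using G by (simp flip: ennreal_mult')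
  finally show ?thesis .
qed

lemma has_bochner_integral_gamma_density:
  assumes "a > 0" "b > 0"
  shows "has_bochner_integral lborel (gamma_density a b) 1"
proof -
  have "has_bochner_integral lborel (gamma_density a 1) 1"
    by (rule has_bochner_integral_nn_integral)
       (use assms in \<open>auto simp: gamma_density_nonneg nn_integral_gamma_density_unit_rate\<close>)
  \<comment> \<open>Substituting \<open>b * x\<close> contributes the factor \<open>1 / b\<close>,
    which the prefactor \<open>b\<close> in \<open>gamma_density_scale\<close> cancels.\<close>
  then have "has_bochner_integral lborel (\<lambda>x. gamma_density a 1 (b * x)) (1 / b)"
    using assms lborel_has_bochner_integral_real_affine_iff[of b "gamma_density a 1" 1 0]
    by (simp add: divide_inverse)
  from has_bochner_integral_mult_right[OF this, of b] show ?thesis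
    using assms by (simp add: gamma_density_scale[OF assms(2), of a, abs_def])
qed

text \<open>The cdf comes from a nonnegative integral in \<open>ennreal\<close>; integrability of
  the density turns it into a Bochner integral, which can then be used in linear
  combinations.\<close>

lemma gamma_density_lower_tail:
  assumes "a > 0" "b > 0"
  shows "has_bochner_integral lborel (\<lambda>x. indicator {..r} x * gamma_density a b x)
           (cdf (gamma_distribution a b) r)"
proof -
  note I = has_bochner_integral_gamma_density[OF assms]
  have int: "integrable lborel (\<lambda>x. indicator {..r} x * gamma_density a b x)"
    using integrable_mult_indicator[OF _ integrable.intros[OF I], of "{..r}"] by simp
  have "emeasure (gamma_distribution a b) {..r}
      = (\<integral>\<^sup>+x. ennreal (indicator {..r} x * gamma_density a b x) \<partial>lborel)"
    unfolding gamma_distribution_def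
    by (subst emeasure_density) (auto intro!: nn_integral_cong simp: indicator_def)
  also have "\<dots> = ennreal (\<integral>x. indicator {..r} x * gamma_density a b x \<partial>lborel)"
    by (rule nn_integral_eq_integral[OF int]) (simp add: gamma_density_nonneg[OF assms])
  finally have "cdf (gamma_distribution a b) r
      = (\<integral>x. indicator {..r} x * gamma_density a b x \<partial>lborel)"
    by (simp add: cdf_def measure_def gamma_density_nonneg[OF assms])
  with int show ?thesis
    by (simp add: has_bochner_integral_iff)
qed

text \<open>This is total mass 1 minus the lower tail. The half-lines \<open>{..r}\<close> and
  \<open>{r..}\<close> share the point \<open>r\<close>, so the integrands agree only off that null
  set.\<close>

lemma gamma_density_upper_tail:
  assumes "a > 0" "b > 0"
  shows "has_bochner_integral lborel (\<lambda>x. indicator {r..} x * gamma_density a b x)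
           (1 - cdf (gamma_distribution a b) r)"
proof (subst has_bochner_integral_cong_AE)
  show "has_bochner_integral lborel
      (\<lambda>x. gamma_density a b x - indicator {..r} x * gamma_density a b x)
      (1 - cdf (gamma_distribution a b) r)"
    by (intro has_bochner_integral_diff has_bochner_integral_gamma_density
          gamma_density_lower_tail assms)
  show "AE x in lborel. indicator {r..} x * gamma_density a b x
      = gamma_density a b x - indicator {..r} x * gamma_density a b x"
    using AE_lborel_singleton[of r] by eventually_elim (auto simp: indicator_def)
qed measurable

text \<open>Each polynomial weight is expanded in powers of \<open>x\<close>, each power is absorbed
  into a shape shift, and the tails are summed. Using \<open>has_bochner_integral\<close> delivers
  integrability together with the value.\<close>

lemma gamma_loss_integrands:
  assumes a: "a > 0" and b: "b > 0"
  defines "F \<equiv> \<lambda>i. cdf (gamma_distribution (a + i) b)"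
  shows "has_bochner_integral lborel (\<lambda>x. indicator {r..} x * ((x - r) * gamma_density a b x))
           (a / b * (1 - F 1 r) - r * (1 - F 0 r))"
    and "has_bochner_integral lborel (\<lambda>x. indicator {..r} x * ((r - x) * gamma_density a b x))
           (r * F 0 r - a / b * F 1 r)"
    and "has_bochner_integral lborel (\<lambda>x. indicator {r..} x * ((x - r)\<^sup>2 * gamma_density a b x))
           (r\<^sup>2 * (1 - F 0 r) - 2 * r * a / b * (1 - F 1 r) + a * (a + 1) / b\<^sup>2 * (1 - F 2 r))"
proof -
  let ?f = "\<lambda>i. gamma_density (a + i) b"
  have f1: "x * ?f 0 x = a / b * ?f 1 x" for x
    using times_gamma_density[OF a b] by simp
  \<comment> \<open>Two successive shifts give the factors \<open>a / b\<close> and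
    \<open>(a + 1) / b\<close>.\<close>
  have f2: "x\<^sup>2 * ?f 0 x = a * (a + 1) / b\<^sup>2 * ?f 2 x" for x
  proof -
    have "x\<^sup>2 * ?f 0 x = a / b * (x * ?f 1 x)"
      using arg_cong[OF f1[of x], of "(*) x"] by (simp add: power2_eq_square mult_ac)
    also have "x * ?f 1 x = (a + 1) / b * ?f 2 x"
      using times_gamma_density[of "a + 1" b x] a b by (simp add: add.assoc)
    finally show ?thesis
      by (simp add: power2_eq_square)
  qed
  have lower: "has_bochner_integral lborel (\<lambda>x. c * (indicator {..r} x * ?f i x)) (c * F i r)"
    and upper: "has_bochner_integral lborel (\<lambda>x. c * (indicator {r..} x * ?f i x)) (c * (1 - F i r))"
    if "i \<ge> 0" for c i
    unfolding F_def using a b that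
    by (auto intro!: has_bochner_integral_mult_right gamma_density_lower_tail
          gamma_density_upper_tail)
  have e1: "(\<lambda>x. indicator {r..} x * ((x - r) * gamma_density a b x))
      = (\<lambda>x. a / b * (indicator {r..} x * ?f 1 x) - r * (indicator {r..} x * ?f 0 x))"
    using f1 by (auto simp: fun_eq_iff indicator_def left_diff_distrib)
  show "has_bochner_integral lborel (\<lambda>x. indicator {r..} x * ((x - r) * gamma_density a b x))
      (a / b * (1 - F 1 r) - r * (1 - F 0 r))"
    unfolding e1 by (intro has_bochner_integral_diff upper) auto
  have e2: "(\<lambda>x. indicator {..r} x * ((r - x) * gamma_density a b x))
      = (\<lambda>x. r * (indicator {..r} x * ?f 0 x) - a / b * (indicator {..r} x * ?f 1 x))"
    using f1 by (auto simp: fun_eq_iff indicator_def left_diff_distrib)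
  show "has_bochner_integral lborel (\<lambda>x. indicator {..r} x * ((r - x) * gamma_density a b x))
      (r * F 0 r - a / b * F 1 r)"
    unfolding e2 by (intro has_bochner_integral_diff lower) auto
  have expand: "(x - r)\<^sup>2 * ?f 0 x
      = r\<^sup>2 * ?f 0 x - 2 * r * a / b * ?f 1 x + a * (a + 1) / b\<^sup>2 * ?f 2 x" for x
  proof -
    have "(x - r)\<^sup>2 * ?f 0 x = r\<^sup>2 * ?f 0 x - 2 * r * (x * ?f 0 x) + x\<^sup>2 * ?f 0 x"
      by (simp add: power2_eq_square algebra_simps)
    then show ?thesis
      unfolding f1 f2 by simp
  qed
  have e3: "(\<lambda>x. indicator {r..} x * ((x - r)\<^sup>2 * gamma_density a b x))
      = (\<lambda>x. r\<^sup>2 * (indicator {r..} x * ?f 0 x) - 2 * r * a / b * (indicator {r..} x * ?f 1 x)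
          + a * (a + 1) / b\<^sup>2 * (indicator {r..} x * ?f 2 x))"
    using expand by (auto simp: fun_eq_iff indicator_def)
  show "has_bochner_integral lborel (\<lambda>x. indicator {r..} x * ((x - r)\<^sup>2 * gamma_density a b x))
      (r\<^sup>2 * (1 - F 0 r) - 2 * r * a / b * (1 - F 1 r) + a * (a + 1) / b\<^sup>2 * (1 - F 2 r))"
    unfolding e3 by (intro has_bochner_integral_add has_bochner_integral_diff upper) auto
qed

text \<open>Here \<open>g\<close> is an arbitrary density of \<open>X\<close>. The integrability
  claims are included because a non-integrable function has integral 0 by convention, so the
  equations alone would not show that the integrals exist.\<close>

theorem mainTheorem6:
  fixes M :: "'a measure" and X :: "'a \<Rightarrow> real" and g :: "real \<Rightarrow> real"
    and \<alpha> \<beta> r :: real and F :: "nat \<Rightarrow> real \<Rightarrow> real"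
  assumes "\<alpha> > 0" and "\<beta> > 0"
    and "prob_space M"
    and "distributed M lborel X (\<lambda>x. ennreal (gamma_density \<alpha> \<beta> x))"
    and "is_pdf M X g"
    and "\<And>i. i \<in> {0, 1, 2} \<Longrightarrow> F i = cdf (gamma_distribution (\<alpha> + real i) \<beta>)"
    and "r \<ge> 0"
  shows "set_integrable lborel {r..} (\<lambda>x. (x - r) * g x) \<and>
         set_integrable lborel {..r} (\<lambda>x. (r - x) * g x) \<and>
         set_integrable lborel {r..} (\<lambda>x. (x - r)\<^sup>2 * g x) \<and>
         first_order_loss g r = \<alpha> / \<beta> * (1 - F 1 r) - r * (1 - F 0 r) \<and>
         complementary_loss g r = r * F 0 r - \<alpha> / \<beta> * F 1 r \<and>
         second_order_loss g r =
           r\<^sup>2 / 2 * (1 - F 0 r) - r * \<alpha> / \<beta> * (1 - F 1 r)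
           + \<alpha> * (\<alpha> + 1) / (2 * \<beta>\<^sup>2) * (1 - F 2 r)"
proof -
  interpret prob_space M by fact
  have g [measurable]: "g \<in> borel_measurable borel" and g0: "\<And>x. 0 \<le> g x"
    and dg: "distributed M lborel X (\<lambda>x. ennreal (g x))"
    using assms(5) by (auto simp: is_pdf_def)
  \<comment> \<open>Densities of the same variable are unique almost everywhere as
    \<open>ennreal\<close> functions; nonnegativity of both carries the equality over to the
    reals.\<close>
  have ae: "AE x in lborel. g x = gamma_density \<alpha> \<beta> x"
    using distributed_unique[OF dg assms(4)]
    by eventually_elim (use g0 gamma_density_nonneg[OF assms(1,2)] in simp)
  \<comment> \<open>A null set affects neither integrability nor the value, so results for
    \<open>gamma_density\<close> pass to \<open>g\<close> under any measurable weight
    \<open>h\<close>.\<close>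
  have transfer: "set_integrable lborel S (\<lambda>x. h x * g x)
      \<and> (LBINT x:S. h x * g x) = v"
    if I: "has_bochner_integral lborel (\<lambda>x. indicator S x * (h x * gamma_density \<alpha> \<beta> x)) v"
      and [measurable]: "S \<in> sets borel" "h \<in> borel_measurable borel" for S h v
  proof -
    have "AE x in lborel. indicator S x * (h x * g x)
        = indicator S x * (h x * gamma_density \<alpha> \<beta> x)"
      using ae by eventually_elim simp
    then have "has_bochner_integral lborel (\<lambda>x. indicator S x * (h x * g x)) v"
      using I by (subst has_bochner_integral_cong_AE) auto
    then show ?thesis
      by (simp add: set_integrable_def set_lebesgue_integral_def has_bochner_integral_iff)
  qed
  \<comment> \<open>The shape is kept as \<open>\<alpha> + 0\<close> so that these equations match
    the instances of \<open>gamma_loss_integrands\<close> syntactically when folded.\<close>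
  have F: "F 0 = cdf (gamma_distribution (\<alpha> + 0) \<beta>)" "F 1 = cdf (gamma_distribution (\<alpha> + 1) \<beta>)"
    "F 2 = cdf (gamma_distribution (\<alpha> + 2) \<beta>)"
    using assms(6)[of 0] assms(6)[of 1] assms(6)[of 2] by simp_all
  note T = gamma_loss_integrands[OF assms(1,2), of r, folded F, THEN transfer]
  have "set_integrable lborel {r..} (\<lambda>x. (x - r) * g x)
      \<and> (LBINT x:{r..}. (x - r) * g x) = \<alpha> / \<beta> * (1 - F 1 r) - r * (1 - F 0 r)"
    by (rule T(1)) measurable
  moreover have "set_integrable lborel {..r} (\<lambda>x. (r - x) * g x)
      \<and> (LBINT x:{..r}. (r - x) * g x) = r * F 0 r - \<alpha> / \<beta> * F 1 r"
    by (rule T(2)) measurable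
  moreover have "set_integrable lborel {r..} (\<lambda>x. (x - r)\<^sup>2 * g x)
      \<and> (LBINT x:{r..}. (x - r)\<^sup>2 * g x)
        = r\<^sup>2 * (1 - F 0 r) - 2 * r * \<alpha> / \<beta> * (1 - F 1 r)
          + \<alpha> * (\<alpha> + 1) / \<beta>\<^sup>2 * (1 - F 2 r)"
    by (rule T(3)) measurable
  \<comment> \<open>This distributes the factor \<open>1 / 2\<close> from
    \<open>second_order_loss\<close>; \<open>A\<close>, \<open>B\<close>, \<open>C\<close> stand for
    the three upper tail probabilities.\<close>
  moreover have "1 / 2 * (r\<^sup>2 * A - 2 * r * \<alpha> / \<beta> * B + \<alpha> * (\<alpha> + 1) / \<beta>\<^sup>2 * C)
      = r\<^sup>2 / 2 * A - r * \<alpha> / \<beta> * B + \<alpha> * (\<alpha> + 1) / (2 * \<beta>\<^sup>2) * C" for A B C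
    using assms(2) by (simp add: field_simps)
  ultimately show ?thesis
    unfolding first_order_loss_def complementary_loss_def second_order_loss_def by simp
qed

end
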